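(* Let $n,m\ge 1$ be integers and $I=[0,1]$. Then $I^n$ and $I^m$ are homeomorphic if and only if $n=m$.
   Context: The cubes $I^n=[0,1]^n$ and $I^m=[0,1]^m$ carry their usual (Euclidean) topologies. *)

theory Defs
  imports "HOL-Analysis.Analysis"
begin

text \<open>The index type plays the role of \<open>{1..n}\<close>, with \<open>n = CARD('n)\<close>.  Types are nonempty,
  so \<open>n \<ge> 1\<close> holds automatically.\<close>

definition unit_cube :: "(real ^ 'n) set" where
  "unit_cube = {x. \<forall>i. x $ i \<in> {0..1}}"

end

theory Submission
  imports Defs
begin

text \<open>Compact convex sets are homeomorphic exactly when their affine dimensions agree:
  necessity is invariance of dimension, sufficiency radial rescaling. A cube is compact and convex,
  so only its affine dimension matters.\<close>

lemma unit_cube_eq_cbox: "unit_cube = cbox 0 (1 :: real ^ 'n::finite)"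
  by (auto simp: unit_cube_def mem_box_cart)

lemma aff_dim_unit_cube: "aff_dim (unit_cube :: (real ^ 'n::finite) set) = int CARD('n)"
proof -
  \<comment> \<open>The centre of the cube is an interior point, so the affine hull is the whole
    space.\<close>
  have "(\<chi> i. 1/2) \<in> box 0 (1 :: real ^ 'n)"
    by (simp add: mem_box_cart)
  then have "interior (unit_cube :: (real ^ 'n) set) \<noteq> {}"
    by (metis empty_iff interior_cbox unit_cube_eq_cbox)
  then show ?thesis
    by (simp add: aff_dim_nonempty_interior)
qed

theorem corollary4p7:
  "(unit_cube :: (real ^ 'n::finite) set) homeomorphic (unit_cube :: (real ^ 'm::finite) set)
     \<longleftrightarrow> CARD('n) = CARD('m)"
proof -
  have "(unit_cube :: (real ^ 'n) set) homeomorphic (unit_cube :: (real ^ 'm) set)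
     \<longleftrightarrow> aff_dim (unit_cube :: (real ^ 'n) set) = aff_dim (unit_cube :: (real ^ 'm) set)"
    \<comment> \<open>Convexity and compactness are read off from the \<open>cbox\<close>
      form.\<close>
    by (intro homeomorphic_convex_compact_sets_eq) (simp_all add: unit_cube_eq_cbox)
  then show ?thesis
    by (simp add: aff_dim_unit_cube)
qed

end
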